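(* Let $G$ be a graph, let $\omega$ be a countable end of $G$, and let $\mathcal{R}$ be any set of pairwise vertex-disjoint $\omega$-rays. Then there exists a set $\mathcal{R}'$ of pairwise vertex-disjoint $\omega$-rays that devours $\omega$ and such that the set of start vertices of the rays in $\mathcal{R}'$ equals the set of start vertices of the rays in $\mathcal{R}$.
   Context: All graphs are simple and undirected (possibly infinite). A ray is a one-way infinite path; its start vertex is its unique vertex of degree $1$. Two rays of $G$ are equivalent if they cannot be separated by finitely many vertices (i.e., for every finite $X\subseteq V(G)$, the tails of the two rays avoiding $X$ lie in the same component of $G-X$); the equivalence classes are the ends of $G$, and a ray in an end $\omega$ is an $\omega$-ray. An end $\omega$ is countable if $G$ does not contain uncountably many pairwise disjoint $\omega$-rays. A set of $\omega$-rays devours $\omega$ if every $\omega$-ray of $G$ meets (shares a vertex with) at least one ray of the set.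
   Formalization: The formal theorem additionally assumes that the given set of rays is nonempty; for the empty set the claim fails, since the new set would also have to be empty and an end, being a nonempty class of rays, is not devoured by the empty set. *)

theory Defs
  imports Main "HOL-Library.Countable_Set"
begin

definition simple_graph :: "'a set \<Rightarrow> 'a set set \<Rightarrow> bool" where
  "simple_graph V E \<longleftrightarrow> (\<forall>e\<in>E. \<exists>u\<in>V. \<exists>v\<in>V. u \<noteq> v \<and> e = {u, v})"

definition conn :: "'a set \<Rightarrow> 'a set set \<Rightarrow> ('a \<times> 'a) set" where
  "conn V E = {(u, v). u \<in> V \<and> v \<in> V \<and> (u, v) \<in> {(x, y). {x, y} \<in> E}\<^sup>*}"

definition components :: "'a set \<Rightarrow> 'a set set \<Rightarrow> 'a set set" where
  "components V E = V // conn V E"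

definition components_minus :: "'a set \<Rightarrow> 'a set set \<Rightarrow> 'a set \<Rightarrow> 'a set set" where
  "components_minus V E X = components (V - X) {e \<in> E. e \<inter> X = {}}"

text \<open>A ray is encoded by the enumeration of its vertices from the start vertex, which is
  uniquely determined by the ray; its vertex set is \<open>range r\<close>.\<close>

definition rays :: "'a set \<Rightarrow> 'a set set \<Rightarrow> (nat \<Rightarrow> 'a) set" where
  "rays V E = {r. inj r \<and> range r \<subseteq> V \<and> (\<forall>n. {r n, r (Suc n)} \<in> E)}"

definition start :: "(nat \<Rightarrow> 'a) \<Rightarrow> 'a" where
  "start r = r 0"

definition ray_equiv :: "'a set \<Rightarrow> 'a set set \<Rightarrow> ((nat \<Rightarrow> 'a) \<times> (nat \<Rightarrow> 'a)) set" where
  "ray_equiv V E = {(r, s). r \<in> rays V E \<and> s \<in> rays V E \<and>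
     (\<forall>X. X \<subseteq> V \<and> finite X \<longrightarrow>
        (\<exists>C\<in>components_minus V E X. \<exists>m n. r ` {m..} \<subseteq> C \<and> s ` {n..} \<subseteq> C))}"

definition ends :: "'a set \<Rightarrow> 'a set set \<Rightarrow> (nat \<Rightarrow> 'a) set set" where
  "ends V E = rays V E // ray_equiv V E"

definition disjoint_rays :: "(nat \<Rightarrow> 'a) set \<Rightarrow> bool" where
  "disjoint_rays R \<longleftrightarrow> pairwise (\<lambda>r s. range r \<inter> range s = {}) R"

text \<open>Not countability of the class \<open>\<omega>\<close> itself: the bound is on disjoint families in it.\<close>

definition countable_end :: "(nat \<Rightarrow> 'a) set \<Rightarrow> bool" where
  "countable_end \<omega> \<longleftrightarrow> \<not> (\<exists>R. R \<subseteq> \<omega> \<and> disjoint_rays R \<and> uncountable R)"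

definition devours :: "(nat \<Rightarrow> 'a) set \<Rightarrow> (nat \<Rightarrow> 'a) set \<Rightarrow> bool" where
  "devours R \<omega> \<longleftrightarrow> R \<subseteq> \<omega> \<and> (\<forall>r\<in>\<omega>. \<exists>s\<in>R. range r \<inter> range s \<noteq> {})"

lemma equiv_conn: "equiv V (conn V E)"
proof (rule equivI)
  show "conn V E \<subseteq> V \<times> V"
    by (auto simp: conn_def)
  show "refl_on V (conn V E)"
    by (auto simp: refl_on_def conn_def)
  have "sym {(x, y). {x, y} \<in> E}"
    by (auto simp: sym_def insert_commute)
  then have "sym ({(x, y). {x, y} \<in> E}\<^sup>*)"
    by (rule sym_rtrancl)
  then show "sym (conn V E)"
    by (auto simp: sym_def conn_def)
  show "trans (conn V E)"
    by (auto simp: trans_def conn_def intro: rtrancl_trans)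
qed

lemma ray_tail_in_component:
  assumes r: "r \<in> rays V E" and X: "finite X"
  shows "\<exists>C\<in>components_minus V E X. \<exists>m. r ` {m..} \<subseteq> C"
proof -
  let ?F = "{e \<in> E. e \<inter> X = {}}"
  have "finite {n. r n \<in> X}"
    using finite_vimageI[OF X, of r] r by (simp add: rays_def vimage_def)
  then obtain m where m: "\<And>n. n \<ge> m \<Longrightarrow> r n \<notin> X"
    unfolding finite_nat_set_iff_bounded by (meson linorder_not_less mem_Collect_eq)
  have V: "r n \<in> V" for n
    using r by (auto simp: rays_def)
  have "(r m, r n) \<in> {(x, y). {x, y} \<in> ?F}\<^sup>*" if "n \<ge> m" for n
    using that
  proof (induction n rule: dec_induct)
    case (step n)
    have "{r n, r (Suc n)} \<in> ?F"
      using r m[of n] m[of "Suc n"] step.hyps by (auto simp: rays_def)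
    then show ?case
      using step.IH by (auto intro: rtrancl_into_rtrancl)
  qed simp
  then have "r ` {m..} \<subseteq> conn (V - X) ?F `` {r m}"
    using V m by (auto simp: conn_def)
  moreover have "conn (V - X) ?F `` {r m} \<in> components_minus V E X"
    unfolding components_minus_def components_def using V m by (intro quotientI) auto
  ultimately show ?thesis by blast
qed

lemma equiv_ray_equiv: "equiv (rays V E) (ray_equiv V E)"
proof (rule equivI)
  show "ray_equiv V E \<subseteq> rays V E \<times> rays V E"
    by (auto simp: ray_equiv_def)
  show "refl_on (rays V E) (ray_equiv V E)"
  proof (rule refl_onI)
    fix r assume r: "r \<in> rays V E"
    have "\<exists>C\<in>components_minus V E X. \<exists>m n. r ` {m..} \<subseteq> C \<and> r ` {n..} \<subseteq> C"
      if X: "finite X" for X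
    proof -
      obtain C m where "C \<in> components_minus V E X" "r ` {m..} \<subseteq> C"
        using ray_tail_in_component[OF r X] by (elim bexE exE)
      then show ?thesis
        by (intro bexI[of _ C] exI[of _ m] conjI)
    qed
    then show "(r, r) \<in> ray_equiv V E"
      using r by (simp add: ray_equiv_def)
  qed
  show "sym (ray_equiv V E)"
  proof (rule symI)
    fix r s assume "(r, s) \<in> ray_equiv V E"
    moreover have "(\<exists>m n. r ` {m..} \<subseteq> C \<and> s ` {n..} \<subseteq> C) \<longleftrightarrow>
        (\<exists>m n. s ` {m..} \<subseteq> C \<and> r ` {n..} \<subseteq> C)" for C
      by metis
    ultimately show "(s, r) \<in> ray_equiv V E"
      by (simp add: ray_equiv_def)
  qed
  show "trans (ray_equiv V E)"
  proof (rule transI)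
    fix r s t
    assume rs: "(r, s) \<in> ray_equiv V E" and st: "(s, t) \<in> ray_equiv V E"
    have "\<exists>C\<in>components_minus V E X. \<exists>m n. r ` {m..} \<subseteq> C \<and> t ` {n..} \<subseteq> C"
      if X: "X \<subseteq> V" "finite X" for X
    proof -
      obtain C m n where C: "C \<in> components_minus V E X" "r ` {m..} \<subseteq> C" "s ` {n..} \<subseteq> C"
        using rs X unfolding ray_equiv_def mem_Collect_eq prod.case by metis
      obtain D k l where D: "D \<in> components_minus V E X" "s ` {k..} \<subseteq> D" "t ` {l..} \<subseteq> D"
        using st X unfolding ray_equiv_def mem_Collect_eq prod.case by metis
      have "s (max n k) \<in> C \<inter> D"
        using C(3) D(2) by auto
      then have "C = D"
        using quotient_disj[OF equiv_conn] C(1) D(1)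
        unfolding components_minus_def components_def by blast
      then show ?thesis
        using C(1,2) D(3) by metis
    qed
    then show "(r, t) \<in> ray_equiv V E"
      using rs st by (simp add: ray_equiv_def)
  qed
qed

text \<open>Ends are nonempty, so no end is devoured by the empty set; this is why a set of rays whose
  start vertices are to be preserved by a devouring set has to be assumed nonempty.\<close>

lemma not_devours_empty:
  assumes "\<omega> \<in> ends V E"
  shows "\<not> devours {} \<omega>"
  using in_quotient_imp_non_empty[OF equiv_ray_equiv assms[unfolded ends_def]]
  by (auto simp: devours_def)

end

theory Submission
  imports Defs
begin

text \<open>A maximal family of disjoint rays of \<open>\<omega>\<close> covers only countably many vertices, and every ray
  of \<open>\<omega>\<close> passes through one of them; so it suffices to prevent each such vertex \<open>u\<close> from being the
  start of a ray of \<open>\<omega>\<close> that avoids the constructed family. The family arises as the limit of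
  growing finite initial segments. To deal with \<open>u\<close>, consider all families that respect the
  segments fixed so far and choose one whose distance from \<open>u\<close>, measured outside the fixed
  segments, is minimal. If \<open>u\<close> is not covered, let \<open>v q\<close> be the last edge of a shortest path, where
  \<open>q\<close> lies on the ray starting at \<open>x\<close>, and fix that ray up to \<open>q\<close>. If a ray of \<open>\<omega>\<close> from \<open>u\<close> avoided
  some later family, then so would one from \<open>v\<close>, and letting the ray of \<open>x\<close> turn at \<open>q\<close> into \<open>v\<close>
  would give a family closer to \<open>u\<close>.\<close>

section \<open>Equivalence of rays\<close>

definition edges_avoiding :: "'a set set \<Rightarrow> 'a set \<Rightarrow> ('a \<times> 'a) set" where
  "edges_avoiding E F = {(a, b). {a, b} \<in> E \<and> {a, b} \<inter> F = {}}"

definition edges_within :: "'a set set \<Rightarrow> 'a set \<Rightarrow> ('a \<times> 'a) set" where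
  "edges_within E B = {(a, b). {a, b} \<in> E \<and> {a, b} \<subseteq> B}"

lemma edges_avoiding_conn:
  "conn (V - F) {e \<in> E. e \<inter> F = {}} =
    {(a, b). a \<in> V - F \<and> b \<in> V - F \<and> (a, b) \<in> (edges_avoiding E F)\<^sup>*}"
  by (simp add: conn_def edges_avoiding_def)

text \<open>A component containing a tail of \<open>s\<close> contains the matching tail of
  \<open>r\<close>. Cutting, prolonging or splicing leaves some tail unchanged, so the results stay
  in the end.\<close>

lemma ray_equivI_shift:
  assumes r: "r \<in> rays V E" and s: "s \<in> rays V E" and eq: "\<And>i. r (i + a) = s (i + b)"
  shows "(r, s) \<in> ray_equiv V E"
proof -
  have "\<exists>C\<in>components_minus V E X. \<exists>m n. r ` {m..} \<subseteq> C \<and> s ` {n..} \<subseteq> C" if X: "finite X" for X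
  proof -
    obtain C m where C: "C \<in> components_minus V E X" "s ` {m..} \<subseteq> C"
      using ray_tail_in_component[OF s X] by (elim bexE exE)
    have "r j \<in> C" if "j \<ge> m + a" for j
    proof -
      have "r j = s (j - a + b)" using eq[of "j - a"] that by simp
      then show ?thesis using C(2) that by auto
    qed
    then have "r ` {m + a..} \<subseteq> C" by auto
    then show ?thesis using C by metis
  qed
  then show ?thesis using r s by (simp add: ray_equiv_def)
qed

lemma ray_equiv_connected:
  assumes graph: "simple_graph V E" and "(r, s) \<in> ray_equiv V E" and "finite F"
  shows "\<exists>m n. r m \<notin> F \<and> (r m, s n) \<in> (edges_avoiding E F)\<^sup>*"
proof -
  \<comment> \<open>\<open>ray_equiv\<close> only speaks of deleted sets inside \<open>V\<close>.
    Since edges lie in \<open>V\<close>, deleting \<open>F \<inter> V\<close> leaves the same edges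
    as deleting \<open>F\<close>.\<close>
  have "F \<inter> V \<subseteq> V \<and> finite (F \<inter> V)" using assms(3) by simp
  then obtain C m n
    where C: "C \<in> components_minus V E (F \<inter> V)" "r ` {m..} \<subseteq> C" "s ` {n..} \<subseteq> C"
    using assms(2) unfolding ray_equiv_def mem_Collect_eq prod.case by metis
  have "r m \<in> C" "s n \<in> C" using C by auto
  then have "(r m, s n) \<in> conn (V - F \<inter> V) {e \<in> E. e \<inter> (F \<inter> V) = {}}"
    using quotient_eq_iff[OF equiv_conn C(1)[unfolded components_minus_def components_def]
        C(1)[unfolded components_minus_def components_def]] by simp
  moreover have "e \<inter> (F \<inter> V) = e \<inter> F" if "e \<in> E" for e
    using bspec[OF graph[unfolded simple_graph_def] that] by auto
  then have "edges_avoiding E (F \<inter> V) = edges_avoiding E F"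
    unfolding edges_avoiding_def by (intro Collect_cong) auto
  ultimately show ?thesis by (auto simp: edges_avoiding_conn)
qed

text \<open>A walk visits finitely many vertices. Collecting them in \<open>B\<close> turns a
  connection off \<open>F\<close> into a finite object, so that further connections can be chosen
  disjoint from it.\<close>

lemma rtrancl_edges_avoiding_finite:
  assumes "(a, b) \<in> (edges_avoiding E F)\<^sup>*" and "a \<notin> F"
  shows "\<exists>B. finite B \<and> B \<inter> F = {} \<and> a \<in> B \<and> b \<in> B \<and> (a, b) \<in> (edges_within E B)\<^sup>*"
  using assms
proof (induction rule: rtrancl_induct)
  case base
  then show ?case by (intro exI[of _ "{a}"]) auto
next
  case (step b c)
  then obtain B where B: "finite B" "B \<inter> F = {}" "a \<in> B" "b \<in> B" "(a, b) \<in> (edges_within E B)\<^sup>*"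
    by blast
  have "edges_within E B \<subseteq> edges_within E (insert c B)"
    by (auto simp: edges_within_def)
  then have "(a, b) \<in> (edges_within E (insert c B))\<^sup>*"
    using B(5) rtrancl_mono by blast
  moreover have "(b, c) \<in> edges_within E (insert c B)" "c \<notin> F"
    using step.hyps(2) B(4) by (auto simp: edges_within_def edges_avoiding_def)
  ultimately show ?case
    using B by (intro exI[of _ "insert c B"]) (auto intro: rtrancl_into_rtrancl)
qed

text \<open>Only the first \<open>K + 1\<close> vertices of \<open>r\<close> matter for \<open>bridges E i r K s\<close>, so it survives changes
  of \<open>r\<close> beyond \<open>K\<close>; this is what puts the limit rays into the end.\<close>

definition bridges :: "'a set set \<Rightarrow> nat \<Rightarrow> (nat \<Rightarrow> 'a) \<Rightarrow> nat \<Rightarrow> (nat \<Rightarrow> 'a) \<Rightarrow> bool" where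
  "bridges E i r K s \<longleftrightarrow> (\<exists>D. finite D \<and> card D = i \<and> pairwise disjnt D \<and>
     (\<forall>B\<in>D. finite B \<and> (\<exists>k\<le>K. \<exists>l. r k \<in> B \<and> s l \<in> B \<and> (r k, s l) \<in> (edges_within E B)\<^sup>*)))"

lemma bridges_cong:
  assumes "bridges E i r K s" and "\<And>k. k \<le> K \<Longrightarrow> r' k = r k" and "K \<le> K'"
  shows "bridges E i r' K' s"
proof -
  obtain D where D: "finite D" "card D = i" "pairwise disjnt D"
    "\<forall>B\<in>D. finite B \<and> (\<exists>k\<le>K. \<exists>l. r k \<in> B \<and> s l \<in> B \<and> (r k, s l) \<in> (edges_within E B)\<^sup>*)"
    using assms(1) unfolding bridges_def by blast
  have "\<forall>B\<in>D. finite B \<and> (\<exists>k\<le>K'. \<exists>l. r' k \<in> B \<and> s l \<in> B \<and> (r' k, s l) \<in> (edges_within E B)\<^sup>*)"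
    using D(4) assms(2,3) by (metis order_trans)
  then show ?thesis unfolding bridges_def using D(1-3) by blast
qed

text \<open>Greedy choice: the \<open>i\<close> bridges found so far have a finite union, and
  equivalence of the rays yields a connection avoiding it.\<close>

lemma ray_equiv_imp_bridges:
  assumes "simple_graph V E" and "(r, s) \<in> ray_equiv V E"
  shows "\<exists>K. bridges E i r K s"
proof (induction i)
  case 0
  show ?case unfolding bridges_def by (intro exI[of _ 0] exI[of _ "{}"]) auto
next
  case (Suc i)
  then obtain K D where D: "finite D" "card D = i" "pairwise disjnt D"
    "\<forall>B\<in>D. finite B \<and> (\<exists>k\<le>K. \<exists>l. r k \<in> B \<and> s l \<in> B \<and> (r k, s l) \<in> (edges_within E B)\<^sup>*)"
    unfolding bridges_def by blast
  have "finite (\<Union>D)" using D by auto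
  then obtain m n where mn: "r m \<notin> \<Union>D" "(r m, s n) \<in> (edges_avoiding E (\<Union>D))\<^sup>*"
    using ray_equiv_connected[OF assms] by blast
  then obtain B where B: "finite B" "B \<inter> \<Union>D = {}" "r m \<in> B" "s n \<in> B"
      "(r m, s n) \<in> (edges_within E B)\<^sup>*"
    using rtrancl_edges_avoiding_finite[of "r m" "s n" E "\<Union>D"] by blast
  have "B \<notin> D" using B(2,3) by auto
  then have "card (insert B D) = Suc i" using D by simp
  moreover have "pairwise disjnt (insert B D)"
    using D(3) B(2) by (auto simp: pairwise_insert disjnt_def)
  moreover have "\<exists>k\<le>max K m. \<exists>l. r k \<in> B' \<and> s l \<in> B' \<and> (r k, s l) \<in> (edges_within E B')\<^sup>*"
    if "B' \<in> insert B D" for B'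
    using that D(4) B(3-5) by (metis insertE max.cobounded1 max.cobounded2 order_trans)
  ultimately have "bridges E (Suc i) r (max K m) s"
    unfolding bridges_def using D(1,4) B(1) by (intro exI[of _ "insert B D"]) auto
  then show ?case by blast
qed

text \<open>Pigeonhole: among more than \<open>card Y\<close> disjoint bridges one misses the finite
  set \<open>Y\<close>, and it joins the two tails outside \<open>X\<close>.\<close>

lemma bridges_imp_ray_equiv:
  assumes r: "r \<in> rays V E" and s: "s \<in> rays V E" and br: "\<And>i. \<exists>K. bridges E i r K s"
  shows "(r, s) \<in> ray_equiv V E"
proof -
  have "\<exists>C\<in>components_minus V E X. \<exists>m n. r ` {m..} \<subseteq> C \<and> s ` {n..} \<subseteq> C" if X: "finite X" for X
  proof -
    obtain C m where C: "C \<in> components_minus V E X" "r ` {m..} \<subseteq> C"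
      using ray_tail_in_component[OF r X] by (elim bexE exE)
    obtain C' n where C': "C' \<in> components_minus V E X" "s ` {n..} \<subseteq> C'"
      using ray_tail_in_component[OF s X] by (elim bexE exE)
    \<comment> \<open>With the initial segments included in \<open>Y\<close>, a bridge off
      \<open>Y\<close> must attach to the tails that lie in \<open>C\<close> and
      \<open>C'\<close>.\<close>
    define Y where "Y = X \<union> r ` {..<m} \<union> s ` {..<n}"
    have Y: "finite Y" using X by (simp add: Y_def)
    obtain K D where D: "finite D" "card D = Suc (card Y)" "pairwise disjnt D"
      "\<forall>B\<in>D. finite B \<and> (\<exists>k\<le>K. \<exists>l. r k \<in> B \<and> s l \<in> B \<and> (r k, s l) \<in> (edges_within E B)\<^sup>*)"
      using br[of "Suc (card Y)"] unfolding bridges_def by blast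
    have "\<exists>B\<in>D. B \<inter> Y = {}"
    proof (rule ccontr)
      assume "\<not> ?thesis"
      then have "\<forall>B\<in>D. \<exists>y. y \<in> B \<inter> Y" by blast
      then obtain y where y: "\<forall>B\<in>D. y B \<in> B \<inter> Y" by metis
      have "inj_on y D"
      proof (rule inj_onI, rule ccontr)
        fix A B assume AB: "A \<in> D" "B \<in> D" "y A = y B" "A \<noteq> B"
        then have "A \<inter> B = {}" using D(3) by (auto simp: pairwise_def disjnt_def)
        then show False using y AB(1-3) by (metis IntD1 IntI empty_iff)
      qed
      moreover have "y ` D \<subseteq> Y" using y by auto
      ultimately have "card D \<le> card Y" using Y by (metis card_inj_on_le)
      then show False using D(2) by simp
    qed
    then obtain B where BD: "B \<in> D" and BY: "B \<inter> Y = {}" by blast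
    obtain k l where B: "B \<inter> Y = {}" "r k \<in> B" "s l \<in> B" "(r k, s l) \<in> (edges_within E B)\<^sup>*"
      using bspec[OF D(4) BD] BY by (elim conjE exE)
    have "r k \<notin> Y" "s l \<notin> Y" using B(1-3) by auto
    then have kl: "k \<ge> m" "l \<ge> n" "r k \<notin> X" "s l \<notin> X"
      unfolding Y_def by (auto simp: linorder_not_less[symmetric])
    have "edges_within E B \<subseteq> edges_avoiding E X"
      using B(1) by (auto simp: edges_within_def edges_avoiding_def Y_def)
    then have "(r k, s l) \<in> (edges_avoiding E X)\<^sup>*"
      using B(4) rtrancl_mono by blast
    then have "(r k, s l) \<in> conn (V - X) {e \<in> E. e \<inter> X = {}}"
      using r s kl by (auto simp: edges_avoiding_conn rays_def)
    moreover have "r k \<in> C" "s l \<in> C'" using C(2) C'(2) kl by auto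
    ultimately have "C = C'"
      using quotient_eqI[OF equiv_conn C(1)[unfolded components_minus_def components_def]
          C'(1)[unfolded components_minus_def components_def]] by simp
    then show ?thesis using C C' by metis
  qed
  then show ?thesis using r s by (simp add: ray_equiv_def)
qed

section \<open>Families of disjoint rays with prescribed start vertices\<close>

locale graph_end =
  fixes V :: "'a set" and E :: "'a set set" and \<omega> :: "(nat \<Rightarrow> 'a) set"
  assumes graph: "simple_graph V E" and is_end: "\<omega> \<in> ends V E"
begin

section \<open>Rays of the end obtained from other rays of the end\<close>

lemma end_ray: "r \<in> \<omega> \<Longrightarrow> r \<in> rays V E"
  using is_end in_quotient_imp_subset[OF equiv_ray_equiv] unfolding ends_def by blast

lemma end_equiv: "r \<in> \<omega> \<Longrightarrow> s \<in> \<omega> \<Longrightarrow> (r, s) \<in> ray_equiv V E"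
  using quotient_eq_iff[OF equiv_ray_equiv is_end[unfolded ends_def] is_end[unfolded ends_def]]
  by simp

lemma end_closed: "r \<in> \<omega> \<Longrightarrow> (s, r) \<in> ray_equiv V E \<Longrightarrow> s \<in> \<omega>"
  using in_quotient_imp_closed[OF equiv_ray_equiv is_end[unfolded ends_def]]
    equiv_ray_equiv[of V E] by (meson equivE symD)

lemma end_nonempty: "\<omega> \<noteq> {}"
  using in_quotient_imp_non_empty[OF equiv_ray_equiv is_end[unfolded ends_def]] .

lemma tail_in_end:
  assumes "r \<in> \<omega>"
  shows "(\<lambda>i. r (i + m)) \<in> \<omega>"
proof -
  have r: "r \<in> rays V E" using assms end_ray by blast
  then have "(\<lambda>i. r (i + m)) \<in> rays V E"
    by (auto simp: rays_def inj_eq intro!: injI)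
  then have "((\<lambda>i. r (i + m)), r) \<in> ray_equiv V E"
    using r by (rule ray_equivI_shift[where a = 0 and b = m]) simp
  then show ?thesis using end_closed assms by blast
qed

lemma splice_in_end:
  assumes r: "r \<in> \<omega>" and t: "t \<in> \<omega>" and edge: "{r k, t 0} \<in> E"
    and disj: "range r \<inter> range t = {}"
  shows "(\<lambda>i. if i \<le> k then r i else t (i - Suc k)) \<in> \<omega>" (is "?s \<in> \<omega>")
proof -
  have rt: "r \<in> rays V E" "t \<in> rays V E" using r t end_ray by blast+
  have "inj ?s"
  proof (rule injI)
    fix i j assume ij: "?s i = ?s j"
    have ne: "r i \<noteq> t j" for i j using disj by (metis disjoint_iff rangeI)
    have inj: "inj r" "inj t" using rt by (auto simp: rays_def)
    consider "i \<le> k" "j \<le> k" | "i > k" "j > k"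
      using ij ne[of i "j - Suc k"] ne[of j "i - Suc k"] by (auto split: if_splits)
    then show "i = j"
    proof cases
      case 1
      then show ?thesis using ij injD[OF inj(1)] by simp
    next
      case 2
      then have "i - Suc k = j - Suc k" using ij injD[OF inj(2)] by simp
      then show ?thesis using 2 by simp
    qed
  qed
  moreover have "{?s i, ?s (Suc i)} \<in> E" for i
  proof (cases "i = k")
    case False
    show ?thesis
    proof (cases "i < k")
      case True
      then show ?thesis using rt by (simp add: rays_def)
    next
      case F: False
      then have "Suc i - Suc k = Suc (i - Suc k)" using False by simp
      then show ?thesis using rt F False by (simp add: rays_def)
    qed
  qed (simp add: edge)
  ultimately have s: "?s \<in> rays V E" using rt by (auto simp: rays_def)
  have "(?s, t) \<in> ray_equiv V E"
    by (rule ray_equivI_shift[OF s rt(2), where a = "Suc k" and b = 0]) simp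
  then show ?thesis using end_closed t by blast
qed

text \<open>Inclusion rather than equality: if \<open>v\<close> already lies on \<open>t\<close>,
  the ray from \<open>v\<close> is a tail of \<open>t\<close>.\<close>

lemma prepend_in_end:
  assumes t: "t \<in> \<omega>" and edge: "{v, t 0} \<in> E"
  shows "\<exists>s\<in>\<omega>. s 0 = v \<and> range s \<subseteq> insert v (range t)"
proof (cases "v \<in> range t")
  case True
  then obtain m where "v = t m" by blast
  then show ?thesis using tail_in_end[OF t, of m] by (intro bexI[of _ "\<lambda>i. t (i + m)"]) auto
next
  case False
  let ?s = "\<lambda>i. case i of 0 \<Rightarrow> v | Suc j \<Rightarrow> t j"
  have tr: "t \<in> rays V E" using t end_ray by blast
  have "inj ?s"
    using False tr by (auto simp: inj_def rays_def split: nat.splits)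
  moreover have "v \<in> V" using edge graph by (auto simp: simple_graph_def doubleton_eq_iff)
  ultimately have s: "?s \<in> rays V E"
    using tr edge by (auto simp: rays_def image_subset_iff split: nat.splits)
  have "(?s, t) \<in> ray_equiv V E"
    by (rule ray_equivI_shift[OF s tr, where a = 1 and b = 0]) simp
  then have "?s \<in> \<omega>" using end_closed t by blast
  then show ?thesis by (intro bexI[of _ ?s]) (auto split: nat.splits)
qed

text \<open>The bound \<open>d \<le> e\<close> on the added vertices is what a minimality argument
  needs to keep them off a linkage.\<close>

lemma walk_prepend_in_end:
  assumes t: "t \<in> \<omega>" and walk: "(t 0, v) \<in> edges_avoiding E F ^^ e"
  shows "\<exists>s\<in>\<omega>. s 0 = v \<and> range s \<subseteq> range t \<union> {w. \<exists>d\<le>e. (t 0, w) \<in> edges_avoiding E F ^^ d}"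
  using walk
proof (induction e arbitrary: v)
  case 0
  then show ?case using t by (intro bexI[of _ t]) auto
next
  case (Suc e)
  then obtain w where w: "(t 0, w) \<in> edges_avoiding E F ^^ e" "(w, v) \<in> edges_avoiding E F"
    by auto
  obtain s where s: "s \<in> \<omega>" "s 0 = w"
      "range s \<subseteq> range t \<union> {w. \<exists>d\<le>e. (t 0, w) \<in> edges_avoiding E F ^^ d}"
    using Suc.IH[OF w(1)] by blast
  have "{v, s 0} \<in> E" using w(2) s(2) by (auto simp: edges_avoiding_def insert_commute)
  then obtain s' where s': "s' \<in> \<omega>" "s' 0 = v" "range s' \<subseteq> insert v (range s)"
    using prepend_in_end s(1) by blast
  have "range s' \<subseteq> range t \<union> {w. \<exists>d\<le>Suc e. (t 0, w) \<in> edges_avoiding E F ^^ d}"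
  proof
    fix y assume "y \<in> range s'"
    then have "y = v \<or> y \<in> range s" using s'(3) by (meson insertE subsetD)
    then show "y \<in> range t \<union> {w. \<exists>d\<le>Suc e. (t 0, w) \<in> edges_avoiding E F ^^ d}"
    proof
      assume "y = v"
      then show ?thesis using Suc.prems by (intro UnI2 CollectI exI[of _ "Suc e"]) simp
    next
      assume "y \<in> range s"
      then have "y \<in> range t \<or> (\<exists>d\<le>e. (t 0, y) \<in> edges_avoiding E F ^^ d)"
        using subsetD[OF s(3)] by simp
      then show ?thesis unfolding Un_iff mem_Collect_eq by (meson le_SucI)
    qed
  qed
  then show ?case using s'(1,2) by (intro bexI[of _ s'] conjI)
qed

section \<open>Linkages, fixed segments and blocked vertices\<close>

definition linkage :: "'a set \<Rightarrow> ('a \<Rightarrow> nat \<Rightarrow> 'a) \<Rightarrow> bool" where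
  "linkage X f \<longleftrightarrow> (\<forall>x\<in>X. f x \<in> \<omega> \<and> f x 0 = x) \<and>
     (\<forall>x\<in>X. \<forall>y\<in>X. x \<noteq> y \<longrightarrow> range (f x) \<inter> range (f y) = {})"

text \<open>Between linkages, \<open>n x = 0\<close> fixes only the start vertex, which is
  \<open>x\<close> anyway. So finiteness of \<open>{x \<in> X. n x \<noteq> 0}\<close> says that
  only finitely many rays are constrained.\<close>

definition agree :: "'a set \<Rightarrow> ('a \<Rightarrow> nat) \<Rightarrow> ('a \<Rightarrow> nat \<Rightarrow> 'a) \<Rightarrow> ('a \<Rightarrow> nat \<Rightarrow> 'a) \<Rightarrow> bool" where
  "agree X n f g \<longleftrightarrow> (\<forall>x\<in>X. \<forall>k\<le>n x. g x k = f x k)"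

lemma agree_refl: "agree X n f f"
  by (simp add: agree_def)

lemma agree_trans:
  assumes "agree X n f g" and "agree X n' g h" and "\<And>x. n x \<le> n' x"
  shows "agree X n f h"
  unfolding agree_def
proof (intro ballI allI impI)
  fix x k assume "x \<in> X" "k \<le> n x"
  moreover have "k \<le> n' x" using \<open>k \<le> n x\<close> assms(3)[of x] by linarith
  ultimately show "h x k = f x k" using assms(1,2) by (simp add: agree_def)
qed

definition covered :: "'a set \<Rightarrow> ('a \<Rightarrow> nat \<Rightarrow> 'a) \<Rightarrow> 'a set" where
  "covered X f = (\<Union>x\<in>X. range (f x))"

text \<open>Quantifying over all compatible linkages, not just \<open>f\<close>, makes blocking
  persist when more is fixed, and lets it apply to the limit.\<close>

definition blocks :: "'a set \<Rightarrow> ('a \<Rightarrow> nat) \<Rightarrow> ('a \<Rightarrow> nat \<Rightarrow> 'a) \<Rightarrow> 'a \<Rightarrow> bool" where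
  "blocks X n f u \<longleftrightarrow> (\<forall>g s. linkage X g \<longrightarrow> agree X n f g \<longrightarrow> s \<in> \<omega> \<longrightarrow> s 0 = u \<longrightarrow>
     range s \<inter> covered X g \<noteq> {})"

lemma linkage_turn:
  assumes h: "linkage X h" and x: "x \<in> X" and t: "t \<in> \<omega>" and edge: "{h x k, t 0} \<in> E"
    and disj: "range t \<inter> covered X h = {}"
  shows "linkage X (h(x := \<lambda>i. if i \<le> k then h x i else t (i - Suc k)))"
    (is "linkage X (h(x := ?s))")
proof -
  have "range (h x) \<inter> range t = {}" using disj x by (auto simp: covered_def)
  then have s: "?s \<in> \<omega>" using splice_in_end h x t edge by (auto simp: linkage_def)
  have sub: "range ?s \<subseteq> range (h x) \<union> range t" by auto
  have "range ?s \<inter> range (h y) = {}" if y: "y \<in> X" "y \<noteq> x" for y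
  proof -
    have "range (h x) \<inter> range (h y) = {}" using h x y by (simp add: linkage_def)
    moreover have "range t \<inter> range (h y) = {}" using disj y by (auto simp: covered_def)
    ultimately have "(range (h x) \<union> range t) \<inter> range (h y) = {}" by (simp add: Int_Un_distrib2)
    then show ?thesis using Int_mono[OF sub order_refl, of "range (h y)"] by simp
  qed
  then show ?thesis
    using h x s unfolding linkage_def by (auto simp: Int_commute)
qed

text \<open>Either no compatible linkage can be reached from \<open>u\<close> outside the fixed
  segments, or a nearest one is taken. At most one more ray becomes constrained, which preserves
  finiteness.\<close>

lemma exists_blocking_extension:
  assumes f: "linkage X f" and fin: "finite {x \<in> X. n x \<noteq> 0}" and X: "X \<noteq> {}"
  shows "\<exists>f' n'. linkage X f' \<and> agree X n f f' \<and> (\<forall>x. n x \<le> n' x) \<and>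
    finite {x \<in> X. n' x \<noteq> 0} \<and> blocks X n' f' u"
proof -
  \<comment> \<open>The strict bound leaves the last fixed vertex of each segment out of
    \<open>F\<close>: a path may end there and the ray may turn there.\<close>
  define F where "F = (\<Union>x\<in>{x \<in> X. n x \<noteq> 0}. f x ` {..<n x})"
  have finF: "finite F" using fin by (simp add: F_def)
  have F_covered: "F \<subseteq> covered X g" if "agree X n f g" for g
  proof
    fix w assume "w \<in> F"
    then obtain x k where "x \<in> X" "k < n x" "w = f x k" by (auto simp: F_def)
    then have "w = g x k" "x \<in> X" using that by (auto simp: agree_def)
    then show "w \<in> covered X g" by (auto simp: covered_def)
  qed
  define P where "P d \<longleftrightarrow> (\<exists>g w. linkage X g \<and> agree X n f g \<and> w \<in> covered X g \<and>
    (u, w) \<in> edges_avoiding E F ^^ d)" for d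
  show ?thesis
  proof (cases "\<exists>d. P d")
    case False
    \<comment> \<open>A ray from \<open>u\<close> avoiding a compatible linkage also avoids
      \<open>F\<close>. Being equivalent to any \<open>g x\<close>, it yields a walk from
      \<open>u\<close> to \<open>g x\<close> off \<open>F\<close>, against the case
      assumption.\<close>
    have "blocks X n f u"
      unfolding blocks_def
    proof (intro allI impI notI)
      fix g s
      assume g: "linkage X g" "agree X n f g" and s: "s \<in> \<omega>" "s 0 = u"
        and avoid: "range s \<inter> covered X g = {}"
      obtain x where x: "x \<in> X" using X by blast
      then obtain k l where kl: "(s k, g x l) \<in> (edges_avoiding E F)\<^sup>*"
        using ray_equiv_connected[OF graph end_equiv finF, of s "g x"] s g(1)
        by (auto simp: linkage_def)
      have "s i \<notin> F" for i using avoid F_covered[OF g(2)] by auto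
      then have "(s i, s (Suc i)) \<in> edges_avoiding E F" for i
        using end_ray[OF s(1)] by (auto simp: rays_def edges_avoiding_def)
      then have "(s 0, s i) \<in> (edges_avoiding E F)\<^sup>*" for i
        by (induction i) (auto intro: rtrancl_into_rtrancl)
      then have "(u, g x l) \<in> (edges_avoiding E F)\<^sup>*"
        using kl s(2) rtrancl_trans by metis
      then obtain d where "(u, g x l) \<in> edges_avoiding E F ^^ d"
        using rtrancl_imp_relpow by blast
      then have "P d" unfolding P_def covered_def using g x by blast
      then show False using False by blast
    qed
    then show ?thesis using f fin agree_refl by blast
  next
    case True
    \<comment> \<open>\<open>F\<close> depends only on \<open>f\<close> and \<open>n\<close>, so the
      minimum ranges over all compatible linkages at once, including every later
      \<open>h\<close>.\<close>
    define d where "d = (LEAST d. P d)"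
    have "P d" and least: "\<And>e. e < d \<Longrightarrow> \<not> P e"
      unfolding d_def using True by (auto intro: LeastI_ex dest: not_less_Least)
    then obtain g x k where g: "linkage X g" "agree X n f g" and x: "x \<in> X"
        and walk: "(u, g x k) \<in> edges_avoiding E F ^^ d"
      unfolding P_def covered_def by blast
    show ?thesis
    proof (cases d)
      case 0
      then have u: "g x k = u" using walk by simp
      \<comment> \<open>A walk of length 0 has no edge that would keep its end off \<open>F\<close>,
        so \<open>k < n x\<close> is possible; hence the maximum.\<close>
      let ?n = "n(x := max (n x) k)"
      have "blocks X ?n g u"
        unfolding blocks_def
      proof (intro allI impI)
        fix h s assume "linkage X h" "agree X ?n g h" "s \<in> \<omega>" "s 0 = u"
        then have "s 0 = h x k" using u x by (simp add: agree_def)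
        then show "range s \<inter> covered X h \<noteq> {}" using x by (auto simp: covered_def)
      qed
      moreover have "finite {y \<in> X. ?n y \<noteq> 0}"
        by (rule finite_subset[OF _ finite.insertI[OF fin, of x]]) auto
      ultimately show ?thesis
        using g by (intro exI[of _ g] exI[of _ ?n]) auto
    next
      case (Suc e)
      then obtain v where v: "(u, v) \<in> edges_avoiding E F ^^ e"
          "(v, g x k) \<in> edges_avoiding E F"
        using walk by auto
      \<comment> \<open>The last edge of the walk avoids \<open>F\<close>, so \<open>g x k\<close>
        is not an earlier fixed vertex, and setting the bound to \<open>k\<close> releases
        nothing.\<close>
      have nk: "n x \<le> k"
      proof (rule ccontr)
        assume "\<not> n x \<le> k"
        then have "g x k \<in> F" using g(2) x by (auto simp: agree_def F_def)
        then show False using v(2) by (auto simp: edges_avoiding_def)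
      qed
      let ?n = "n(x := k)"
      have "blocks X ?n g u"
        unfolding blocks_def
      proof (intro allI impI notI)
        fix h s
        assume h: "linkage X h" "agree X ?n g h" and s: "s \<in> \<omega>" "s 0 = u"
          and avoid: "range s \<inter> covered X h = {}"
        have fh: "agree X n f h"
          using agree_trans[OF g(2) h(2)] nk by simp
        obtain t where t: "t \<in> \<omega>" "t 0 = v"
            "range t \<subseteq> range s \<union> {w. \<exists>d\<le>e. (u, w) \<in> edges_avoiding E F ^^ d}"
          using walk_prepend_in_end[OF s(1), of v e F] v(1) s(2) by auto
        \<comment> \<open>\<open>h\<close> is compatible too, so it covers no vertex reached in at
          most \<open>e < d\<close> steps. Thus \<open>t\<close>, made of vertices of
          \<open>s\<close> and of such vertices, avoids \<open>h\<close>.\<close>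
        have "{w. \<exists>d\<le>e. (u, w) \<in> edges_avoiding E F ^^ d} \<inter> covered X h = {}"
          using least h(1) fh Suc unfolding P_def by (auto simp: less_Suc_eq_le)
        then have t_avoid: "range t \<inter> covered X h = {}" using t(3) avoid by blast
        have "h x k = g x k" using h(2) x by (simp add: agree_def)
        then have edge: "{h x k, t 0} \<in> E"
          using v(2) t(2) by (auto simp: edges_avoiding_def insert_commute)
        \<comment> \<open>The turned ray has \<open>v\<close> at index \<open>Suc k\<close>, only
          \<open>e\<close> steps from \<open>u\<close>, contradicting the choice of
          \<open>d\<close>.\<close>
        let ?h = "h(x := \<lambda>i. if i \<le> k then h x i else t (i - Suc k))"
        have "linkage X ?h" using linkage_turn[OF h(1) x t(1) edge t_avoid] .
        moreover have "agree X n f ?h" using fh nk by (auto simp: agree_def)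
        moreover have "v = ?h x (Suc k)" using t(2) by simp
        then have "v \<in> covered X ?h" using x unfolding covered_def by blast
        ultimately have "P e" unfolding P_def using v(1) by blast
        then show False using least Suc by simp
      qed
      moreover have "finite {y \<in> X. ?n y \<noteq> 0}"
        by (rule finite_subset[OF _ finite.insertI[OF fin, of x]]) auto
      ultimately show ?thesis
        using g nk by (intro exI[of _ g] exI[of _ ?n]) auto
    qed
  qed
qed

text \<open>Injectivity, edges and disjointness concern two positions at a time, hence a single
  stage. Membership in the end does not, so \<open>br\<close> demands arbitrarily many bridges to
  \<open>r\<close> from within the fixed segments; its part \<open>j \<le> n i x\<close> makes these
  grow without bound.\<close>

lemma linkage_limit:
  assumes f: "\<And>i. linkage X (f i)" and ag: "\<And>i. agree X (n i) (f i) (f (Suc i))"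
    and mono: "\<And>i x. n i x \<le> n (Suc i) x" and r: "r \<in> \<omega>"
    and br: "\<And>x j. x \<in> X \<Longrightarrow> \<exists>i. j \<le> n i x \<and> bridges E j (f i x) (n i x) r"
  shows "\<exists>g. linkage X g \<and> (\<forall>i. agree X (n i) (f i) g)"
proof -
  have le: "n i x \<le> n j x" if "i \<le> j" for i j x
    using lift_Suc_mono_le[of "\<lambda>i. n i x"] mono that by blast
  have ag': "agree X (n i) (f i) (f j)" if "i \<le> j" for i j
    using that
  proof (induction j rule: dec_induct)
    case (step j)
    then show ?case using agree_trans[OF step.IH ag] le by blast
  qed (rule agree_refl)
  \<comment> \<open>The value is read off at the first stage that fixes position \<open>k\<close>.
    For \<open>x \<in> X\<close> such a stage exists by \<open>br\<close>, and later stages agree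
    with it.\<close>
  define g where "g x k = f (LEAST i. k \<le> n i x) x k" for x k
  have g: "g x k = f i x k" if "x \<in> X" "k \<le> n i x" for x k i
  proof -
    have "k \<le> n (LEAST i. k \<le> n i x) x" using that(2) by (rule LeastI)
    moreover have "(LEAST i. k \<le> n i x) \<le> i" using that(2) by (rule Least_le)
    ultimately show ?thesis using ag' that(1) unfolding g_def agree_def by metis
  qed
  have reach: "\<exists>i. \<forall>j\<ge>i. k \<le> n j x" if "x \<in> X" for x k
    using br[OF that, of k] le by (meson order_trans)
  have common: "\<exists>i. g x k = f i x k \<and> g y l = f i y l" if xy: "x \<in> X" "y \<in> X" for x y k l
  proof -
    obtain i i' where "\<forall>j\<ge>i. k \<le> n j x" "\<forall>j\<ge>i'. l \<le> n j y"
      using reach[OF xy(1), of k] reach[OF xy(2), of l] by blast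
    then have "k \<le> n (max i i') x" "l \<le> n (max i i') y" by simp_all
    then show ?thesis using g xy by blast
  qed
  have ray: "f i x \<in> rays V E" if "x \<in> X" for i x
    using f that end_ray by (auto simp: linkage_def)
  have g_ray: "g x \<in> rays V E" if x: "x \<in> X" for x
  proof -
    have "inj (g x)"
    proof (rule injI)
      fix k l assume "g x k = g x l"
      moreover obtain i where "g x k = f i x k" "g x l = f i x l" using common x by blast
      ultimately show "k = l" using ray[OF x, of i] by (auto simp: rays_def dest: injD)
    qed
    moreover have "g x k \<in> V \<and> {g x k, g x (Suc k)} \<in> E" for k
    proof -
      obtain i where "g x k = f i x k" "g x (Suc k) = f i x (Suc k)" using common x by blast
      then show ?thesis using ray[OF x, of i] by (auto simp: rays_def)
    qed
    ultimately show ?thesis by (auto simp: rays_def)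
  qed
  have g_end: "g x \<in> \<omega>" if x: "x \<in> X" for x
  proof -
    have "\<exists>K. bridges E j (g x) K r" for j
    proof -
      obtain i where "bridges E j (f i x) (n i x) r" using br[OF x] by blast
      then have "bridges E j (g x) (n i x) r" by (rule bridges_cong) (use g[OF x] in auto)
      then show ?thesis ..
    qed
    then have "(g x, r) \<in> ray_equiv V E"
      using bridges_imp_ray_equiv g_ray[OF x] end_ray[OF r] by blast
    then show ?thesis using end_closed r by blast
  qed
  have "g x 0 = x" if "x \<in> X" for x
    using g[OF that, of 0 0] f[of 0] that by (simp add: linkage_def)
  moreover have "range (g x) \<inter> range (g y) = {}" if xy: "x \<in> X" "y \<in> X" "x \<noteq> y" for x y
  proof -
    have "g x k \<noteq> g y l" for k l
    proof -
      obtain i where "g x k = f i x k" "g y l = f i y l" using common xy by blast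
      moreover have "range (f i x) \<inter> range (f i y) = {}"
        using f[of i] xy by (simp add: linkage_def)
      ultimately show ?thesis by (metis disjoint_iff rangeI)
    qed
    then show ?thesis by blast
  qed
  ultimately have "linkage X g" using g_end by (simp add: linkage_def)
  moreover have "agree X (n i) (f i) g" for i using g by (simp add: agree_def)
  ultimately show ?thesis by blast
qed

text \<open>Dependent choice on pairs of a linkage and its segment lengths. Step \<open>i\<close>
  blocks \<open>u i\<close> and, for \<open>b i = (x, j)\<close>, fixes the ray of \<open>x\<close>
  at least up to position \<open>j\<close> and far enough to carry \<open>j\<close> bridges to
  \<open>r\<close>.\<close>

lemma exists_blocking_linkage:
  assumes f: "linkage X f" and X: "countable X" "X \<noteq> {}" and U: "countable U" "U \<noteq> {}"
  shows "\<exists>g. linkage X g \<and> (\<forall>s\<in>\<omega>. s 0 \<in> U \<longrightarrow> range s \<inter> covered X g \<noteq> {})"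
proof -
  obtain r where r: "r \<in> \<omega>" using end_nonempty by blast
  define u where "u = from_nat_into U"
  define b where "b = from_nat_into (X \<times> (UNIV :: nat set))"
  have u: "range u = U" unfolding u_def using U by (simp add: range_from_nat_into)
  have b: "range b = X \<times> UNIV"
    unfolding b_def using X by (intro range_from_nat_into) auto
  let ?inv = "\<lambda>p :: ('a \<Rightarrow> nat \<Rightarrow> 'a) \<times> ('a \<Rightarrow> nat). linkage X (fst p) \<and> finite {x \<in> X. snd p x \<noteq> 0}"
  let ?step = "\<lambda>i (p :: ('a \<Rightarrow> nat \<Rightarrow> 'a) \<times> ('a \<Rightarrow> nat)) q.
    agree X (snd p) (fst p) (fst q) \<and> (\<forall>x. snd p x \<le> snd q x) \<and>
    blocks X (snd q) (fst q) (u i) \<and> snd (b i) \<le> snd q (fst (b i)) \<and>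
    bridges E (snd (b i)) (fst q (fst (b i))) (snd q (fst (b i))) r"
  have "\<exists>\<sigma>. \<forall>i. ?inv (\<sigma> i) \<and> ?step i (\<sigma> i) (\<sigma> (Suc i))"
  proof (rule dependent_nat_choice)
    show "\<exists>p. ?inv p" using f by (intro exI[of _ "(f, \<lambda>_. 0)"]) simp
  next
    fix p i assume p: "?inv p"
    obtain f' n' where f': "linkage X f'" "agree X (snd p) (fst p) f'" "\<forall>x. snd p x \<le> n' x"
        "finite {x \<in> X. n' x \<noteq> 0}" "blocks X n' f' (u i)"
      using exists_blocking_extension[of X "fst p" "snd p" "u i"] p X(2) by blast
    obtain x j where xj: "b i = (x, j)" by fastforce
    then have x: "x \<in> X" using b by (metis SigmaE2 rangeI)
    then have "f' x \<in> \<omega>" using f'(1) by (simp add: linkage_def)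
    then obtain K where K: "bridges E j (f' x) K r"
      using ray_equiv_imp_bridges[OF graph end_equiv] r by blast
    \<comment> \<open>Fixing up to \<open>K\<close> preserves the bridges at all later stages;
      fixing up to \<open>j\<close> makes the segment grow.\<close>
    let ?n = "n'(x := max (n' x) (max j K))"
    \<comment> \<open>Fixing more leaves fewer compatible linkages, so blocking is kept.\<close>
    have "agree X n' f' g" if "agree X ?n f' g" for g
      using that by (auto simp: agree_def split: if_splits)
    then have "blocks X ?n f' (u i)" using f'(5) unfolding blocks_def by blast
    moreover have "finite {y \<in> X. ?n y \<noteq> 0}"
      by (rule finite_subset[OF _ finite.insertI[OF f'(4), of x]]) auto
    moreover have "bridges E j (f' x) (?n x) r" by (rule bridges_cong[OF K]) auto
    moreover have "\<forall>y. snd p y \<le> ?n y" using f'(3) by (auto simp: le_max_iff_disj)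
    ultimately have "?inv (f', ?n) \<and> ?step i p (f', ?n)" using f'(1,2) xj by simp
    then show "\<exists>q. ?inv q \<and> ?step i p q" by blast
  qed
  then obtain \<sigma> where \<sigma>: "\<And>i. ?inv (\<sigma> i)" "\<And>i. ?step i (\<sigma> i) (\<sigma> (Suc i))" by blast
  have "\<exists>g. linkage X g \<and> (\<forall>i. agree X (snd (\<sigma> i)) (fst (\<sigma> i)) g)"
  proof (rule linkage_limit[OF _ _ _ r])
    fix x j assume "x \<in> X"
    then have "(x, j) \<in> range b" using b by simp
    then obtain i where "b i = (x, j)" by (metis rangeE)
    \<comment> \<open>Task \<open>b i\<close> is carried out in passing from
      \<open>\<sigma> i\<close> to \<open>\<sigma> (Suc i)\<close>, so \<open>Suc i\<close> is the
      witness.\<close>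
    then show "\<exists>i. j \<le> snd (\<sigma> i) x \<and> bridges E j (fst (\<sigma> i) x) (snd (\<sigma> i) x) r"
      using \<sigma>(2)[of i] by (intro exI[of _ "Suc i"]) simp
  qed (use \<sigma> in blast)+
  then obtain g where g: "linkage X g" "\<And>i. agree X (snd (\<sigma> i)) (fst (\<sigma> i)) g" by blast
  have "range s \<inter> covered X g \<noteq> {}" if s: "s \<in> \<omega>" "s 0 \<in> U" for s
  proof -
    obtain i where "s 0 = u i" using s(2) u by blast
    then show ?thesis using \<sigma>(2)[of i] g(1) g(2)[of "Suc i"] s(1) unfolding blocks_def by blast
  qed
  then show ?thesis using g(1) by blast
qed

section \<open>A countable vertex set met by every ray of the end\<close>

lemma countable_transversal_of_end:
  assumes "countable_end \<omega>"
  shows "\<exists>U. countable U \<and> (\<forall>r\<in>\<omega>. range r \<inter> U \<noteq> {})"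
proof -
  let ?A = "{M. M \<subseteq> \<omega> \<and> disjoint_rays M}"
  have "\<exists>M\<in>?A. \<forall>N\<in>?A. M \<subseteq> N \<longrightarrow> N = M"
  proof (rule subset_Zorn')
    fix C assume C: "subset.chain ?A C"
    have "chain\<^sub>\<subseteq> C" using C unfolding subset_chain_def chain_subset_def by blast
    moreover have "disjoint_rays M" if "M \<in> C" for M
      using C that unfolding subset_chain_def by blast
    \<comment> \<open>Disjointness concerns two rays at a time, and any two rays of the union lie in
      a common member of the chain.\<close>
    ultimately have "disjoint_rays (\<Union>C)"
      unfolding disjoint_rays_def by (intro pairwise_chain_Union) auto
    then show "\<Union>C \<in> ?A" using C by (auto simp: subset.chain_def)
  qed
  then obtain M where "M \<in> ?A" and max: "\<forall>N\<in>?A. M \<subseteq> N \<longrightarrow> N = M"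
    by (elim bexE)
  then have M: "M \<subseteq> \<omega>" "disjoint_rays M" by auto
  have "countable M" using assms M by (auto simp: countable_end_def)
  then have "countable (\<Union>r\<in>M. range r)" by simp
  moreover have "range r \<inter> (\<Union>r\<in>M. range r) \<noteq> {}" if r: "r \<in> \<omega>" for r
  proof
    assume disj: "range r \<inter> (\<Union>r\<in>M. range r) = {}"
    then have "disjoint_rays (insert r M)"
      using M(2) unfolding disjoint_rays_def by (subst pairwise_insert) blast
    \<comment> \<open>Maximality puts \<open>r\<close> into \<open>M\<close>, so
      \<open>range r\<close> would be part of the union that it is assumed to miss.\<close>
    then have "insert r M = M" using bspec[OF max, of "insert r M"] M(1) r by auto
    then show False using disj by blast
  qed
  ultimately show ?thesis by blast
qed

end

section \<open>From blocked start vertices to a devouring family\<close>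

theorem theorem1:
  fixes V :: "'a set" and E :: "'a set set" and \<omega> R :: "(nat \<Rightarrow> 'a) set"
  assumes "simple_graph V E"
    and "\<omega> \<in> ends V E"
    and "countable_end \<omega>"
    and "R \<subseteq> \<omega>"
    and "disjoint_rays R"
    and "R \<noteq> {}"
  shows "\<exists>R'. R' \<subseteq> \<omega> \<and> disjoint_rays R' \<and> devours R' \<omega> \<and> start ` R' = start ` R"
proof -
  interpret graph_end V E \<omega> using assms(1,2) by (rule graph_end.intro)
  define X where "X = start ` R"
  \<comment> \<open>\<open>R\<close> is itself a disjoint family in the countable end; this makes
    the index set \<open>X\<close> enumerable.\<close>
  have "countable R" using assms(3-5) unfolding countable_end_def by blast
  then have X: "countable X" "X \<noteq> {}" using assms(6) by (simp_all add: X_def)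
  define f where "f x = (SOME r. r \<in> R \<and> start r = x)" for x
  have f: "f x \<in> R \<and> start (f x) = x" if "x \<in> X" for x
  proof -
    have "\<exists>r. r \<in> R \<and> start r = x" using that by (auto simp: X_def)
    then show ?thesis unfolding f_def by (rule someI_ex)
  qed
  have "linkage X f"
    unfolding linkage_def
  proof (intro conjI ballI impI)
    fix x y assume "x \<in> X" "y \<in> X" "x \<noteq> y"
    then have "f x \<in> R" "f y \<in> R" "f x \<noteq> f y" using f by metis+
    then show "range (f x) \<inter> range (f y) = {}"
      using assms(5) by (auto simp: disjoint_rays_def pairwise_def)
  qed (use f assms(4) in \<open>auto simp: start_def\<close>)
  moreover obtain U where U: "countable U" "\<forall>r\<in>\<omega>. range r \<inter> U \<noteq> {}"
    using countable_transversal_of_end[OF assms(3)] by (elim exE conjE)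
  moreover have "U \<noteq> {}" using U(2) end_nonempty by auto
  ultimately obtain g where g: "linkage X g"
      "\<forall>s\<in>\<omega>. s 0 \<in> U \<longrightarrow> range s \<inter> covered X g \<noteq> {}"
    using exists_blocking_linkage[OF _ X] by metis
  have in_end: "g ` X \<subseteq> \<omega>" using g(1) by (auto simp: linkage_def)
  have "disjoint_rays (g ` X)"
    unfolding disjoint_rays_def
  proof (rule pairwiseI)
    fix r s assume "r \<in> g ` X" "s \<in> g ` X" "r \<noteq> s"
    then obtain x y where "r = g x" "s = g y" "x \<in> X" "y \<in> X" "x \<noteq> y" by (metis imageE)
    then show "range r \<inter> range s = {}" using g(1) by (simp add: linkage_def)
  qed
  moreover have "devours (g ` X) \<omega>"
    unfolding devours_def
  proof (intro conjI ballI in_end)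
    fix r assume r: "r \<in> \<omega>"
    then obtain m where "r m \<in> U" using bspec[OF U(2)] by blast
    \<comment> \<open>The tail of \<open>r\<close> from position \<open>m\<close> starts in
      \<open>U\<close> and lies in the end, so it meets the linkage, and therefore so does
      \<open>r\<close>.\<close>
    then have "range (\<lambda>i. r (i + m)) \<inter> covered X g \<noteq> {}"
      using bspec[OF g(2) tail_in_end[OF r, of m]] by simp
    then obtain i x where "x \<in> X" "r (i + m) \<in> range (g x)"
      unfolding covered_def by blast
    then show "\<exists>s\<in>g ` X. range r \<inter> range s \<noteq> {}"
      by (intro bexI[of _ "g x"]) auto
  qed
  moreover have "start (g x) = x" if "x \<in> X" for x
    using g(1) that by (simp add: linkage_def start_def)
  then have "start ` g ` X = X"
    unfolding image_image by simp
  ultimately show ?thesis using in_end unfolding X_def by (intro exI[of _ "g ` start ` R"] conjI)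
qed

end
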